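(* (Straight semi-continuous limit of the discrete Boussinesq equation B2.) Let $p,b_0\in\mathbb R$, and let $u_{-1},u_0,u_1:\mathbb R\to\mathbb R$ be smooth. For $q>0$ large put $\epsilon=1/q$, $P=p^3-b_0p^2$, $Q=q^3-b_0q^2$, fix $\xi\in\mathbb R$, and for $\nu,\mu\in\{-1,0,1\}$ set $$x_{\nu,\mu}=p\nu+q\mu+u_\nu(\xi+\epsilon\mu).$$ Let $$E=(P-Q)\left(\frac1{x_{1,-1}-x_{0,0}}-\frac1{x_{0,0}-x_{-1,1}}\right)+b_0(x_{-1,0}-x_{0,-1}+x_{1,0}-x_{0,1})-(x_{1,1}-x_{-1,0})(x_{1,0}-x_{0,1})-(x_{-1,-1}-x_{1,0})(x_{0,-1}-x_{-1,0}).$$ Then, as $q\to\infty$, $q\,E$ converges to $$u_1''+u_0''+u_{-1}''-3u_1'(p-u_0+u_1)+3u_{-1}'(p-u_{-1}+u_0)+(p-u_0+u_1)^3-(p-u_{-1}+u_0)^3-b_0\big[u_{-1}'-u_1'+(2p-u_{-1}+u_1)(u_{-1}-2u_0+u_1)\big],$$ where all functions are evaluated at $\xi$.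
   Context: Primes denote derivatives with respect to $\xi$. $E=0$ is the one-component form of the B2 lattice Boussinesq equation on a $3\times 3$ stencil centred at the origin; the vanishing of the limit is its straight semi-continuous limit. *)

theory Defs
  imports "HOL-Analysis.Analysis"
begin

text \<open>Since \<^term>\<open>deriv\<close> is total, differentiability of the iterates of order up to \<open>n\<close>
  is what makes \<open>(deriv ^^ Suc n) f\<close> the genuine derivative of order \<open>n + 1\<close>.\<close>

definition smooth :: "(real \<Rightarrow> real) \<Rightarrow> bool" where
  "smooth f \<longleftrightarrow> (\<forall>n. (deriv ^^ n) f differentiable_on UNIV)"

definition cubic_param :: "real \<Rightarrow> real \<Rightarrow> real" where
  "cubic_param b0 a = a ^ 3 - b0 * a\<^sup>2"

text \<open>The lattice field \<open>x\<^bsub>\<nu>,\<mu>\<^esub>\<close>, with \<open>\<epsilon> = 1 / q\<close>. Only the indices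
  \<open>\<nu>, \<mu> \<in> {-1, 0, 1}\<close> are relevant.\<close>

definition stencil ::
    "real \<Rightarrow> real \<Rightarrow> (int \<Rightarrow> real \<Rightarrow> real) \<Rightarrow> real \<Rightarrow> int \<Rightarrow> int \<Rightarrow> real" where
  "stencil p q u \<xi> \<nu> \<mu> =
     p * of_int \<nu> + q * of_int \<mu> + u \<nu> (\<xi> + (1 / q) * of_int \<mu>)"

text \<open>The left-hand side of the one-component B2 lattice Boussinesq equation for arbitrary lattice
  values \<open>x\<close> on the \<open>3 \<times> 3\<close> stencil.\<close>

definition B2 :: "real \<Rightarrow> real \<Rightarrow> real \<Rightarrow> (int \<Rightarrow> int \<Rightarrow> real) \<Rightarrow> real" where
  "B2 b0 p q x =
     (cubic_param b0 p - cubic_param b0 q)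
       * (1 / (x 1 (-1) - x 0 0) - 1 / (x 0 0 - x (-1) 1))
     + b0 * (x (-1) 0 - x 0 (-1) + x 1 0 - x 0 1)
     - (x 1 1 - x (-1) 0) * (x 1 0 - x 0 1)
     - (x (-1) (-1) - x 1 0) * (x 0 (-1) - x (-1) 0)"

end

theory Submission
  imports Defs
begin

text \<open>Put \<open>\<alpha> = x\<^bsub>1,-1\<^esub> - x\<^bsub>0,0\<^esub> + q\<close> and \<open>\<beta> = x\<^bsub>0,0\<^esub> - x\<^bsub>-1,1\<^esub> + q\<close>, both of which stay bounded. The
  difference of reciprocals is \<open>(\<beta> - \<alpha>) / ((q - \<alpha>) (q - \<beta>))\<close>, and polynomial division of
  \<open>q (P - Q)\<close> by \<open>(q - \<alpha>) (q - \<beta>)\<close> expands \<open>q E\<close> in powers of \<open>q\<close>. The coefficient of \<open>q\<^sup>2\<close> is the sum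
  of the second differences of \<open>u\<^bsub>1\<^esub>, u\<^bsub>0\<^esub>, u\<^bsub>-1\<^esub>\<close>. The coefficient of \<open>q\<close> vanishes to leading order,
  so it contributes first differences. The constant is \<open>\<alpha>\<^sup>3 - \<beta>\<^sup>3 - b\<^sub>0 (\<alpha>\<^sup>2 - \<beta>\<^sup>2)\<close>, and the remainder
  of the division is negligible.\<close>

lemma smooth_has_deriv:
  assumes "smooth f"
  shows "((deriv ^^ n) f has_real_derivative (deriv ^^ Suc n) f x) (at x)"
proof -
  have "(deriv ^^ n) f differentiable (at x)"
    using assms by (auto simp: smooth_def differentiable_on_def)
  then show ?thesis
    by (simp add: DERIV_deriv_iff_real_differentiable)
qed

text \<open>The target is the punctured filter \<open>at 0\<close>, so that limits of difference
  quotients can be composed with it; this is where \<open>s\<close> must be nonzero.\<close>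

lemma filterlim_const_div_at_0:
  fixes s :: real
  assumes "s \<noteq> 0"
  shows "filterlim (\<lambda>q. s / q) (at 0) at_top"
proof -
  have "((\<lambda>q. s / q) \<longlongrightarrow> 0) at_top"
    by (rule tendsto_divide_0[OF tendsto_const]) (simp add: filterlim_at_top_imp_at_infinity filterlim_ident)
  moreover have "eventually (\<lambda>q. s / q \<noteq> 0) at_top"
    using eventually_gt_at_top[of 0] by eventually_elim (use assms in auto)
  ultimately show ?thesis
    by (simp add: filterlim_at)
qed

lemma first_difference_limit:
  fixes f :: "real \<Rightarrow> real"
  assumes "(f has_real_derivative d) (at x)" "s \<noteq> 0"
  shows "((\<lambda>q. q * (f (x + s / q) - f x)) \<longlongrightarrow> s * d) at_top"
proof -
  have "((\<lambda>h. (f (x + h) - f x) / h) \<longlongrightarrow> d) (at 0)"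
    using assms(1) by (simp add: DERIV_def)
  then have "((\<lambda>q. (f (x + s / q) - f x) / (s / q)) \<longlongrightarrow> d) at_top"
    by (rule filterlim_compose) (rule filterlim_const_div_at_0[OF assms(2)])
  then have "((\<lambda>q. s * ((f (x + s / q) - f x) / (s / q))) \<longlongrightarrow> s * d) at_top"
    by (intro tendsto_intros)
  moreover have "s * ((f (x + s / q) - f x) / (s / q)) = q * (f (x + s / q) - f x)" for q
    using assms(2) by (simp add: mult.commute)
  ultimately show ?thesis by simp
qed

text \<open>One application of l'Hopital's rule in \<open>h = 1 / q\<close> suffices: it leaves the
  symmetric difference quotient of \<open>f'\<close>, which converges by differentiability of
  \<open>f'\<close> at the single point \<open>x\<close>.\<close>

lemma second_difference_limit:
  fixes f f' :: "real \<Rightarrow> real"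
  assumes f: "\<And>y. (f has_real_derivative f' y) (at y)"
    and f': "(f' has_real_derivative d) (at x)"
  shows "((\<lambda>q. q\<^sup>2 * (f (x + 1 / q) + f (x + - 1 / q) - 2 * f x)) \<longlongrightarrow> d) at_top"
proof -
  have pos: "eventually (\<lambda>h::real. 0 < h) (at_right 0)"
    by (simp add: eventually_at_right_less)
  have quot: "((\<lambda>h. (f' (x + h) - f' x) / h) \<longlongrightarrow> d) (at 0)"
    using f' by (simp add: DERIV_def)
  have "((\<lambda>h. (f' (x + h) - f' x) / h) \<longlongrightarrow> d) (at_right 0)"
    using quot by (rule filterlim_mono) (simp_all add: at_le)
  moreover have "((\<lambda>h. (f' (x + - h) - f' x) / (- h)) \<longlongrightarrow> d) (at_right 0)"
    using quot
  proof (rule filterlim_compose)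
    show "filterlim uminus (at 0) (at_right (0::real))"
      by (auto simp: filterlim_at eventually_at_filter intro!: tendsto_eq_intros)
  qed
  \<comment> \<open>The symmetric quotient is the average of the forward and the backward
    quotient.\<close>
  ultimately have "((\<lambda>h. ((f' (x + h) - f' x) / h + (f' (x + - h) - f' x) / (- h)) / 2)
      \<longlongrightarrow> (d + d) / 2) (at_right 0)"
    by (intro tendsto_intros) auto
  then have sym: "((\<lambda>h. (f' (x + h) - f' (x - h)) / (2 * h)) \<longlongrightarrow> d) (at_right 0)"
    by (rule filterlim_cong[THEN iffD1, rotated -1])
       (auto intro!: eventually_mono[OF pos] simp: field_simps)
  have cont: "isCont f y" for y
    using f by (rule DERIV_isCont)
  have "((\<lambda>h. (f (x + h) + f (x - h) - 2 * f x) / h\<^sup>2) \<longlongrightarrow> d) (at_right 0)"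
  proof (rule lhopital_right_0)
    show "((\<lambda>h. f (x + h) + f (x - h) - 2 * f x) \<longlongrightarrow> 0) (at_right 0)"
      by (rule tendsto_eq_intros isCont_tendsto_compose[OF cont] refl | simp)+
    show "((\<lambda>h::real. h\<^sup>2) \<longlongrightarrow> 0) (at_right 0)"
      by (rule tendsto_eq_intros refl | simp)+
    show "eventually (\<lambda>h. ((\<lambda>h. f (x + h) + f (x - h) - 2 * f x)
        has_real_derivative f' (x + h) - f' (x - h)) (at h)) (at_right 0)"
      by (intro always_eventually allI)
        (rule derivative_eq_intros DERIV_chain2[OF f] refl | simp)+
    show "eventually (\<lambda>h. ((\<lambda>h::real. h\<^sup>2) has_real_derivative 2 * h) (at h)) (at_right 0)"
      by (intro always_eventually allI) (rule derivative_eq_intros refl | simp)+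
  qed (use pos sym in \<open>auto elim: eventually_mono\<close>)
  then have "((\<lambda>q. (f (x + 1 / q) + f (x - 1 / q) - 2 * f x) / (1 / q)\<^sup>2) \<longlongrightarrow> d) at_top"
    by (rule filterlim_compose)
       (use filterlim_inverse_at_right_top in \<open>simp add: inverse_eq_divide\<close>)
  then show ?thesis
    by (simp add: power_divide mult.commute)
qed

text \<open>An exact identity, so no error terms have to be estimated. Apart from the three products
  \<open>q * (ap + am)\<close> etc., which are \<open>q^2\<close> times second differences,
  \<open>q\<close> enters only through \<open>1 / q\<close> and through the scaled first
  differences, so every summand has a limit.\<close>

lemma B2_expansion:
  fixes p q b0 \<xi> :: real and u :: "int \<Rightarrow> real \<Rightarrow> real"
  defines "a \<equiv> u 1 \<xi>" and "b \<equiv> u 0 \<xi>" and "c \<equiv> u (-1) \<xi>"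
    and "ap \<equiv> q * (u 1 (\<xi> + 1 / q) - u 1 \<xi>)" and "am \<equiv> q * (u 1 (\<xi> + - 1 / q) - u 1 \<xi>)"
    and "bp \<equiv> q * (u 0 (\<xi> + 1 / q) - u 0 \<xi>)" and "bm \<equiv> q * (u 0 (\<xi> + - 1 / q) - u 0 \<xi>)"
    and "cp \<equiv> q * (u (-1) (\<xi> + 1 / q) - u (-1) \<xi>)"
    and "cm \<equiv> q * (u (-1) (\<xi> + - 1 / q) - u (-1) \<xi>)"
  defines "\<alpha> \<equiv> p + a + 1 / q * am - b" and "\<beta> \<equiv> p + b - c - 1 / q * cp"
  assumes q: "q \<noteq> 0" "1 - 1 / q * \<alpha> \<noteq> 0" "1 - 1 / q * \<beta> \<noteq> 0"
  shows "q * B2 b0 p q (stencil p q u \<xi>) =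
      q * (ap + am) + q * (bp + bm) + q * (cp + cm)
    + ((cp - am) * (2 * b - a - c) - (b0 - (2 * p + a - c)) * (am + cp)
       + (2 * p + a - c - b0) * (bp + bm) + ap * (b - p - a) + cm * (c - p - b)
       + 1 / q * (am\<^sup>2 - cp\<^sup>2 + ap * bp - cm * bm))
    + (\<alpha> ^ 3 - \<beta> ^ 3 - b0 * (\<alpha>\<^sup>2 - \<beta>\<^sup>2))
    + (\<beta> - \<alpha>) *
      (1 / q * (cubic_param b0 p + b0 * (\<alpha>\<^sup>2 + \<alpha> * \<beta> + \<beta>\<^sup>2) - (\<alpha> ^ 3 + \<alpha>\<^sup>2 * \<beta> + \<alpha> * \<beta>\<^sup>2 + \<beta> ^ 3))
       - (1 / q)\<^sup>2 * (\<alpha> * \<beta> * (b0 * (\<alpha> + \<beta>) - (\<alpha>\<^sup>2 + \<alpha> * \<beta> + \<beta>\<^sup>2))))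
      / ((1 - 1 / q * \<alpha>) * (1 - 1 / q * \<beta>))"
proof -
  define e where "e = 1 / q"
  have qe: "q * e = 1" using q by (simp add: e_def)
  have u: "u 1 (\<xi> + 1 / q) = a + e * ap" "u 1 (\<xi> + - 1 / q) = a + e * am"
    "u 0 (\<xi> + 1 / q) = b + e * bp" "u 0 (\<xi> + - 1 / q) = b + e * bm"
    "u (-1) (\<xi> + 1 / q) = c + e * cp" "u (-1) (\<xi> + - 1 / q) = c + e * cm"
    using q by (simp_all add: a_def b_def c_def ap_def am_def bp_def bm_def cp_def cm_def e_def)
  have \<alpha>: "\<alpha> = p + a + e * am - b" and \<beta>: "\<beta> = p + b - c - e * cp"
    by (simp_all add: \<alpha>_def \<beta>_def e_def)
  \<comment> \<open>Taking the factor \<open>q\<close> out of \<open>q - \<alpha>\<close> and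
    \<open>q - \<beta>\<close> leaves denominators that tend to 1.\<close>
  define X where "X = 1 - e * \<alpha>"
  define Y where "Y = 1 - e * \<beta>"
  have XY: "X \<noteq> 0" "Y \<noteq> 0" using q by (simp_all add: X_def Y_def e_def)
  have x1: "1 / (p - q + (a + e * am) - b) = - (e / X)"
  proof -
    have "p - q + (a + e * am) - b = - (X * q)" using q by (simp add: X_def \<alpha> e_def field_simps)
    then show ?thesis by (simp add: e_def)
  qed
  have x2: "1 / (b - (- p + q + (c + e * cp))) = - (e / Y)"
  proof -
    have "b - (- p + q + (c + e * cp)) = - (Y * q)" using q by (simp add: Y_def \<beta> e_def field_simps)
    then show ?thesis by (simp add: e_def)
  qed
  \<comment> \<open>\<open>R\<close> is \<open>e^2\<close> times the remainder, linear in
    \<open>q\<close>, of dividing \<open>q * (P - Q)\<close> by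
    \<open>(q - \<alpha>) * (q - \<beta>)\<close> with \<alpha> and \<beta> held fixed. The sums of
    monomials in \<alpha>, \<beta> are the complete homogeneous symmetric polynomials, the
    coefficients of the expanded reciprocal.\<close>
  define R where "R = (e * (cubic_param b0 p + b0 * (\<alpha>\<^sup>2 + \<alpha> * \<beta> + \<beta>\<^sup>2)
        - (\<alpha> ^ 3 + \<alpha>\<^sup>2 * \<beta> + \<alpha> * \<beta>\<^sup>2 + \<beta> ^ 3))
       - e\<^sup>2 * (\<alpha> * \<beta> * (b0 * (\<alpha> + \<beta>) - (\<alpha>\<^sup>2 + \<alpha> * \<beta> + \<beta>\<^sup>2))))"
  have division: "q * (cubic_param b0 p - cubic_param b0 q) * e\<^sup>2 =
      (- q\<^sup>2 + q * (b0 - \<alpha> - \<beta>) + b0 * (\<alpha> + \<beta>) - (\<alpha>\<^sup>2 + \<alpha> * \<beta> + \<beta>\<^sup>2)) * (X * Y) + R"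
  proof -
    have X: "X = e * (q - \<alpha>)" and Y: "Y = e * (q - \<beta>)" and e: "e = e\<^sup>2 * q"
      using qe by (simp_all add: X_def Y_def algebra_simps power2_eq_square)
    have "q * (cubic_param b0 p - cubic_param b0 q) =
      (- q\<^sup>2 + q * (b0 - \<alpha> - \<beta>) + b0 * (\<alpha> + \<beta>) - (\<alpha>\<^sup>2 + \<alpha> * \<beta> + \<beta>\<^sup>2)) * ((q - \<alpha>) * (q - \<beta>))
      + (q * (cubic_param b0 p + b0 * (\<alpha>\<^sup>2 + \<alpha> * \<beta> + \<beta>\<^sup>2) - (\<alpha> ^ 3 + \<alpha>\<^sup>2 * \<beta> + \<alpha> * \<beta>\<^sup>2 + \<beta> ^ 3))
         - \<alpha> * \<beta> * (b0 * (\<alpha> + \<beta>) - (\<alpha>\<^sup>2 + \<alpha> * \<beta> + \<beta>\<^sup>2)))"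
      unfolding cubic_param_def[of b0 q] by algebra
    moreover have "R = e\<^sup>2 * (q * (cubic_param b0 p + b0 * (\<alpha>\<^sup>2 + \<alpha> * \<beta> + \<beta>\<^sup>2)
          - (\<alpha> ^ 3 + \<alpha>\<^sup>2 * \<beta> + \<alpha> * \<beta>\<^sup>2 + \<beta> ^ 3))
         - \<alpha> * \<beta> * (b0 * (\<alpha> + \<beta>) - (\<alpha>\<^sup>2 + \<alpha> * \<beta> + \<beta>\<^sup>2)))"
      unfolding R_def by (subst (1) e) (simp only: right_diff_distrib mult.assoc)
    ultimately show ?thesis
      unfolding X Y by (simp only: power2_eq_square ring_distribs mult_ac)
  qed
  have "- (e / X) - - (e / Y) = e\<^sup>2 * (\<beta> - \<alpha>) / (X * Y)"
    using XY by (simp add: field_simps) (simp add: X_def Y_def algebra_simps power2_eq_square)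
  then have "q * ((cubic_param b0 p - cubic_param b0 q) * (- (e / X) - - (e / Y))) =
      (\<beta> - \<alpha>) * (q * (cubic_param b0 p - cubic_param b0 q) * e\<^sup>2) / (X * Y)"
    by simp
  also have "\<dots> = (\<beta> - \<alpha>) * (- q\<^sup>2 + q * (b0 - \<alpha> - \<beta>) + b0 * (\<alpha> + \<beta>) - (\<alpha>\<^sup>2 + \<alpha> * \<beta> + \<beta>\<^sup>2))
      + (\<beta> - \<alpha>) * R / (X * Y)"
    unfolding division using XY by (simp add: field_simps)
  finally have frac: "q * ((cubic_param b0 p - cubic_param b0 q) * (- (e / X) - - (e / Y))) =
      (\<beta> - \<alpha>) * (- q\<^sup>2 + q * (b0 - \<alpha> - \<beta>) + b0 * (\<alpha> + \<beta>) - (\<alpha>\<^sup>2 + \<alpha> * \<beta> + \<beta>\<^sup>2))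
      + (\<beta> - \<alpha>) * R / (X * Y)" .
  have "q * B2 b0 p q (stencil p q u \<xi>) =
      q * ((cubic_param b0 p - cubic_param b0 q) * (- (e / X) - - (e / Y)))
      + q * (b0 * (a + c - (b + e * bm) - (b + e * bp))
        + (q + 2 * p + (a + e * ap) - c) * (q - p - a + (b + e * bp))
        - (q + 2 * p + a - (c + e * cm)) * (q - p + c - (b + e * bm)))"
    unfolding x1[symmetric] x2[symmetric] B2_def stencil_def
    using u by (simp add: a_def[symmetric] b_def[symmetric] c_def[symmetric]) (simp add: algebra_simps)
  also have "\<dots> =
      q * (ap + am) + q * (bp + bm) + q * (cp + cm)
    + ((cp - am) * (2 * b - a - c) - (b0 - (2 * p + a - c)) * (am + cp)
       + (2 * p + a - c - b0) * (bp + bm) + ap * (b - p - a) + cm * (c - p - b)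
       + e * (am\<^sup>2 - cp\<^sup>2 + ap * bp - cm * bm))
    + (\<alpha> ^ 3 - \<beta> ^ 3 - b0 * (\<alpha>\<^sup>2 - \<beta>\<^sup>2)) + (\<beta> - \<alpha>) * R / (X * Y)"
  proof -
    \<comment> \<open>Here \<open>\<beta> - \<alpha> = 2 * b - a - c - e * (am + cp)\<close> and
      \<open>\<alpha> + \<beta> = 2 * p + a - c + e * (am - cp)\<close>. The parts free of
      differences cancel at orders \<open>q^2\<close> and \<open>q\<close>, and
      \<open>q * (am + cp)\<close> completes the three second differences.\<close>
    have "(\<beta> - \<alpha>) * (- q\<^sup>2 + q * (b0 - \<alpha> - \<beta>))
      + q * (b0 * (a + c - (b + e * bm) - (b + e * bp))
        + (q + 2 * p + (a + e * ap) - c) * (q - p - a + (b + e * bp))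
        - (q + 2 * p + a - (c + e * cm)) * (q - p + c - (b + e * bm))) =
      q * (ap + am) + q * (bp + bm) + q * (cp + cm)
      + ((cp - am) * (2 * b - a - c) - (b0 - (2 * p + a - c)) * (am + cp)
        + (2 * p + a - c - b0) * (bp + bm) + ap * (b - p - a) + cm * (c - p - b)
        + e * (am\<^sup>2 - cp\<^sup>2 + ap * bp - cm * bm))"
      using q unfolding \<alpha> \<beta> e_def by (simp add: field_simps) (simp add: algebra_simps power2_eq_square)
    \<comment> \<open>Multiplication by \<open>\<beta> - \<alpha>\<close> telescopes the homogeneous
      sums into differences of powers.\<close>
    moreover have "(\<beta> - \<alpha>) * (b0 * (\<alpha> + \<beta>) - (\<alpha>\<^sup>2 + \<alpha> * \<beta> + \<beta>\<^sup>2)) =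
        \<alpha> ^ 3 - \<beta> ^ 3 - b0 * (\<alpha>\<^sup>2 - \<beta>\<^sup>2)"
      by algebra
    ultimately show ?thesis
      unfolding frac by (simp only: diff_conv_add_uminus distrib_left add.assoc)
  qed
  finally show ?thesis
    unfolding R_def X_def Y_def e_def .
qed

theorem mainTheorem5:
  fixes p b0 \<xi> :: real and u :: "int \<Rightarrow> real \<Rightarrow> real"
  assumes "\<And>\<nu>. \<nu> \<in> {-1, 0, 1} \<Longrightarrow> smooth (u \<nu>)"
  shows "((\<lambda>q. q * B2 b0 p q (stencil p q u \<xi>)) \<longlongrightarrow>
      (deriv ^^ 2) (u 1) \<xi> + (deriv ^^ 2) (u 0) \<xi> + (deriv ^^ 2) (u (-1)) \<xi>
      - 3 * deriv (u 1) \<xi> * (p - u 0 \<xi> + u 1 \<xi>)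
      + 3 * deriv (u (-1)) \<xi> * (p - u (-1) \<xi> + u 0 \<xi>)
      + (p - u 0 \<xi> + u 1 \<xi>) ^ 3 - (p - u (-1) \<xi> + u 0 \<xi>) ^ 3
      - b0 * (deriv (u (-1)) \<xi> - deriv (u 1) \<xi>
              + (2 * p - u (-1) \<xi> + u 1 \<xi>) * (u (-1) \<xi> - 2 * u 0 \<xi> + u 1 \<xi>)))
    at_top"
proof -
  have sm: "smooth (u 1)" "smooth (u 0)" "smooth (u (-1))" using assms by auto
  have d1: "(u \<nu> has_real_derivative deriv (u \<nu>) y) (at y)"
    and d2: "(deriv (u \<nu>) has_real_derivative (deriv ^^ 2) (u \<nu>) y) (at y)" if "smooth (u \<nu>)" for \<nu> y
    using smooth_has_deriv[OF that, of 0 y] smooth_has_deriv[OF that, of 1 y]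
    by (simp_all add: numeral_2_eq_2)
  define D where "D \<nu> s = (\<lambda>q. q * (u \<nu> (\<xi> + s / q) - u \<nu> \<xi>))" for \<nu> s
  have D: "(D \<nu> 1 \<longlongrightarrow> deriv (u \<nu>) \<xi>) at_top" "(D \<nu> (- 1) \<longlongrightarrow> - deriv (u \<nu>) \<xi>) at_top"
    if "smooth (u \<nu>)" for \<nu>
    using first_difference_limit[OF d1[OF that], of 1 \<xi>] first_difference_limit[OF d1[OF that], of "- 1" \<xi>]
    by (simp_all add: D_def)
  have D2: "((\<lambda>q. q * (D \<nu> 1 q + D \<nu> (- 1) q)) \<longlongrightarrow> (deriv ^^ 2) (u \<nu>) \<xi>) at_top"
    if "smooth (u \<nu>)" for \<nu>
    using second_difference_limit[OF d1[OF that] d2[OF that]]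
    by (simp add: D_def algebra_simps power2_eq_square)
  have e: "((\<lambda>q::real. 1 / q) \<longlongrightarrow> 0) at_top"
    using filterlim_const_div_at_0[of 1] by (simp add: filterlim_at)
  note lims = D[OF sm(1)] D[OF sm(2)] D[OF sm(3)] D2[OF sm(1)] D2[OF sm(2)] D2[OF sm(3)] e
  define \<alpha> where "\<alpha> q = p + u 1 \<xi> + 1 / q * D 1 (- 1) q - u 0 \<xi>" for q
  define \<beta> where "\<beta> q = p + u 0 \<xi> - u (-1) \<xi> - 1 / q * D (-1) 1 q" for q
  have \<alpha>: "(\<alpha> \<longlongrightarrow> p + u 1 \<xi> - u 0 \<xi>) at_top" and \<beta>: "(\<beta> \<longlongrightarrow> p + u 0 \<xi> - u (-1) \<xi>) at_top"
    unfolding \<alpha>_def \<beta>_def by (rule lims tendsto_eq_intros refl | simp)+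
  \<comment> \<open>These limits make the denominators eventually nonzero, as the expansion
    requires, and also justify the limit of the final quotient.\<close>
  have X: "((\<lambda>q. 1 - 1 / q * \<alpha> q) \<longlongrightarrow> 1) at_top" and Y: "((\<lambda>q. 1 - 1 / q * \<beta> q) \<longlongrightarrow> 1) at_top"
    by (rule \<alpha> \<beta> e tendsto_eq_intros refl | simp)+
  have "eventually (\<lambda>q. q \<noteq> 0 \<and> 1 - 1 / q * \<alpha> q \<noteq> 0 \<and> 1 - 1 / q * \<beta> q \<noteq> 0) at_top"
    using tendsto_imp_eventually_ne[OF X, of 0] tendsto_imp_eventually_ne[OF Y, of 0]
      eventually_gt_at_top[of "0::real"]
    by (auto elim: eventually_elim2 simp: eventually_conj_iff eventually_mono)
  then have expansion: "eventually (\<lambda>q. q * B2 b0 p q (stencil p q u \<xi>) =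
      q * (D 1 1 q + D 1 (- 1) q) + q * (D 0 1 q + D 0 (- 1) q) + q * (D (-1) 1 q + D (-1) (- 1) q)
    + ((D (-1) 1 q - D 1 (- 1) q) * (2 * u 0 \<xi> - u 1 \<xi> - u (-1) \<xi>)
       - (b0 - (2 * p + u 1 \<xi> - u (-1) \<xi>)) * (D 1 (- 1) q + D (-1) 1 q)
       + (2 * p + u 1 \<xi> - u (-1) \<xi> - b0) * (D 0 1 q + D 0 (- 1) q)
       + D 1 1 q * (u 0 \<xi> - p - u 1 \<xi>) + D (-1) (- 1) q * (u (-1) \<xi> - p - u 0 \<xi>)
       + 1 / q * ((D 1 (- 1) q)\<^sup>2 - (D (-1) 1 q)\<^sup>2 + D 1 1 q * D 0 1 q - D (-1) (- 1) q * D 0 (- 1) q))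
    + (\<alpha> q ^ 3 - \<beta> q ^ 3 - b0 * ((\<alpha> q)\<^sup>2 - (\<beta> q)\<^sup>2))
    + (\<beta> q - \<alpha> q) *
      (1 / q * (cubic_param b0 p + b0 * ((\<alpha> q)\<^sup>2 + \<alpha> q * \<beta> q + (\<beta> q)\<^sup>2)
          - (\<alpha> q ^ 3 + (\<alpha> q)\<^sup>2 * \<beta> q + \<alpha> q * (\<beta> q)\<^sup>2 + \<beta> q ^ 3))
       - (1 / q)\<^sup>2 * (\<alpha> q * \<beta> q * (b0 * (\<alpha> q + \<beta> q) - ((\<alpha> q)\<^sup>2 + \<alpha> q * \<beta> q + (\<beta> q)\<^sup>2))))
      / ((1 - 1 / q * \<alpha> q) * (1 - 1 / q * \<beta> q))) at_top"
    unfolding \<alpha>_def \<beta>_def D_def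
    by (rule eventually_mono) (elim conjE, rule B2_expansion)
  show ?thesis
    unfolding tendsto_cong[OF expansion]
    \<comment> \<open>In the limit \<open>bp + bm\<close> drops out, and \<open>ap\<close>,
      \<open>am\<close>, \<open>cp\<close>, \<open>cm\<close> become plus or minus
      \<open>deriv (u 1) \<xi>\<close> and \<open>deriv (u (-1)) \<xi>\<close>; collecting these
      gives the factors 3 and the first-derivative part of the \<open>b0\<close> bracket. The
      product in that bracket is \<open>\<alpha>^2 - \<beta>^2\<close> factored.\<close>
    by (rule lims \<alpha> \<beta> X Y tendsto_eq_intros refl)+ (simp, simp, algebra)
qed

end
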